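(* Let $k$, $\mathfrak t$, $w$ be positive integers and $z$ a nonnegative integer, and let $\ell=\lfloor\log_2 k\rfloor+1$. Then there exists a covering system $\mathcal C=\{r_j\pmod{m_j}:1\le j\le\tau\}$ together with distinct primes $p_1,\dots,p_\tau$, $p_j\mid 2^{m_j}-1$, such that $k_2^{(z;t)}\equiv -2^{-r_j}\pmod{p_j}$ for all $1\le j\le\tau$ and all positive integers $t\equiv\mathfrak t\pmod w$ (i.e. $\mathcal C$ produces $k_2^{(z;t)}$ as a Sierpiński number for all such $t$ via the covering system method) if and only if there exists a covering system $\mathcal C'=\{r'_j\pmod{m'_j}:1\le j\le\tau'\}$ together with distinct primes $p'_1,\dots,p'_{\tau'}$, $p'_j\mid 2^{m'_j}-1$, such that $k_2^{(z;t')}\equiv 2^{-r'_j}\pmod{p'_j}$ for all $1\le j\le\tau'$ and all positive integers $t'\equiv-\mathfrak t\pmod w$ (i.e. $\mathcal C'$ produces $k_2^{(z;t')}$ as a Riesel number for all such $t'$ via the covering system method).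
   Context: A covering system of the integers is a finite collection of congruences $r_j \pmod{m_j}$ such that every integer satisfies at least one of them. $2^{-r}\pmod p$ denotes the inverse of $2^r$ modulo the odd prime $p$. For integers $k\ge1$, $t\ge1$, $z\ge0$, the $2$-repstring is $k_2^{(z;t)}=k\,(2^{(z+\ell)t}-1)/(2^{z+\ell}-1)$ with $\ell=\lfloor\log_2 k\rfloor+1$. The covering system method: if $n\equiv r_j\pmod{m_j}$ and $K\equiv -2^{-r_j}\pmod{p_j}$ then $p_j\mid K\cdot 2^n+1$ (Sierpiński case), and if $K\equiv 2^{-r_j}\pmod{p_j}$ then $p_j\mid K\cdot2^n-1$ (Riesel case). *)

theory Defs
  imports Complex_Main "HOL-Number_Theory.Number_Theory"
begin

definition bin_length :: "nat \<Rightarrow> nat" where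
  "bin_length k = nat \<lfloor>log 2 (real k)\<rfloor> + 1"

text \<open>The division below is exact for \<open>k \<ge> 1\<close> (see \<open>repstring_exact\<close>).\<close>

definition repstring :: "nat \<Rightarrow> nat \<Rightarrow> nat \<Rightarrow> nat" where
  "repstring k z t =
     k * (2 ^ ((z + bin_length k) * t) - 1) div (2 ^ (z + bin_length k) - 1)"

lemma repstring_exact:
  "real (repstring k z t) =
     real k * (2 ^ ((z + bin_length k) * t) - 1) / (2 ^ (z + bin_length k) - 1)"
proof -
  define L where "L = z + bin_length k"
  have L: "L > 0" by (simp add: L_def bin_length_def)
  have "(2 ^ L - 1 :: int) dvd (2 ^ L) ^ t - 1"
    by (metis dvd_triv_left power_diff_1_eq)
  hence "int (2 ^ L - 1) dvd int (2 ^ (L * t) - 1)"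
    by (simp add: power_mult of_nat_diff)
  hence "(2 ^ L - 1 :: nat) dvd k * (2 ^ (L * t) - 1)"
    by (simp only: int_dvd_int_iff dvd_mult)
  hence "real (k * (2 ^ (L * t) - 1) div (2 ^ L - 1))
      = real (k * (2 ^ (L * t) - 1)) / real (2 ^ L - 1)"
    by (rule real_of_nat_div)
  thus ?thesis
    by (simp add: repstring_def L_def of_nat_diff)
qed

text \<open>The congruences \<open>r j (mod m j)\<close>, indexed by \<open>1 \<le> j \<le> \<tau>\<close>; congruence modulo 0 is
  excluded.\<close>

definition covering_system :: "nat \<Rightarrow> (nat \<Rightarrow> int) \<Rightarrow> (nat \<Rightarrow> nat) \<Rightarrow> bool" where
  "covering_system \<tau> r m \<longleftrightarrow>
     (\<forall>j\<in>{1..\<tau>}. m j > 0) \<and>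
     (\<forall>n::int. \<exists>j\<in>{1..\<tau>}. [n = r j] (mod int (m j)))"

text \<open>Residues are arbitrary integers, so powers of 2 modulo \<open>p\<close> need integer exponents.
  For \<open>r \<ge> 0\<close>, \<open>pow2_mod p (- r)\<close> is the inverse of \<open>2 ^ r\<close> modulo \<open>p\<close>. Only meaningful for
  odd \<open>p\<close>.\<close>

definition pow2_mod :: "nat \<Rightarrow> int \<Rightarrow> int" where
  "pow2_mod p e =
     (if e \<ge> 0 then 2 ^ nat e else modular_inverse (int p) (2 ^ nat (- e)))"

end

theory Submission
  imports Defs
begin

text \<open>
  Write \<open>A t\<close> for the repstring and \<open>Q = 2 ^ L\<close> with \<open>L = z + \<ell>\<close>. Then \<open>A (s + t) = A s + Q ^ s * A t\<close>.
  If \<open>A\<close> is constant modulo an odd \<open>p\<close> on the class of \<open>T\<close> modulo \<open>w\<close>, then \<open>p\<close> divides \<open>A w\<close>, so \<open>A\<close> modulo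
  \<open>p\<close> is periodic with period \<open>w\<close> and vanishes at the multiples of \<open>w\<close>. Hence
  \<open>A T' \<equiv> - Q ^ T' * A T\<close> whenever \<open>w\<close> divides \<open>T + T'\<close>: the sign changes and the exponent of \<open>2\<close>
  grows by \<open>L * T'\<close>, which does not depend on \<open>p\<close>. So the same moduli and primes work after
  translating the whole covering system by \<open>- L * T'\<close>.
\<close>

text \<open>The geometric series replaces the quotient and its truncated subtractions by a sum that
  can be split at any index.\<close>

lemma repstring_eq_sum:
  "repstring k z t = k * (\<Sum>i<t. (2 ^ (z + bin_length k)) ^ i)"
proof -
  define L where "L = z + bin_length k"
  have L: "L > 0" by (simp add: L_def bin_length_def)
  hence gt: "(2::nat) ^ L > 1" by (rule one_less_power[rotated]) simp
  have "int (2 ^ (L * t) - 1) = int ((2 ^ L - 1) * (\<Sum>i<t. (2 ^ L) ^ i))"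
    using power_diff_1_eq[of "2 ^ L :: int" t] by (simp add: power_mult of_nat_diff)
  hence "(2::nat) ^ (L * t) - 1 = (2 ^ L - 1) * (\<Sum>i<t. (2 ^ L) ^ i)"
    by (simp only: of_nat_eq_iff)
  hence "k * (2 ^ (L * t) - 1) = (k * (\<Sum>i<t. (2 ^ L) ^ i)) * (2 ^ L - 1)"
    by (simp add: mult_ac)
  thus ?thesis
    using gt unfolding repstring_def L_def[symmetric] by (simp only: nonzero_mult_div_cancel_right)
qed

lemma repstring_add:
  "repstring k z (s + t) =
     repstring k z s + 2 ^ ((z + bin_length k) * s) * repstring k z t"
proof -
  define Q :: nat where "Q = 2 ^ (z + bin_length k)"
  have "(\<Sum>i<s + t. Q ^ i) = (\<Sum>i<s. Q ^ i) + Q ^ s * (\<Sum>i<t. Q ^ i)"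
    by (induction t) (simp_all add: algebra_simps power_add)
  thus ?thesis
    by (simp add: repstring_eq_sum power_mult distrib_left mult.left_commute flip: Q_def)
qed

lemma dvd_repstring_mult:
  assumes "d dvd repstring k z w"
  shows "d dvd repstring k z (w * n)"
  using assms by (induction n) (simp_all add: repstring_add repstring_eq_sum[of k z 0])

text \<open>For \<open>t = n * w + s\<close>, the terms of index at least \<open>s\<close>
  contribute a power of 2 times \<open>repstring k z (w * n)\<close>, a multiple of
  \<open>d\<close>.\<close>

lemma repstring_cong:
  assumes "d dvd repstring k z w" and "[s = t] (mod w)"
  shows "[repstring k z s = repstring k z t] (mod d)"
  using assms(2)
proof (induction s t rule: linorder_wlog)
  case (le s t)
  hence "\<exists>n. t = n * w + s"
    using cong_le_nat[of s t w] by (simp only: cong_sym_eq)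
  then obtain n where n: "t = n * w + s" ..
  have "[repstring k z t = repstring k z s] (mod d)"
    using dvd_repstring_mult[OF assms(1), of n]
    by (simp add: n add.commute[of _ s] mult.commute[of n] repstring_add cong_def mod_add_eq
      dvd_imp_mod_0 flip: mod_add_right_eq)
  thus ?case by (rule cong_sym)
next
  case (sym s t)
  thus ?case by (simp add: cong_sym_eq)
qed

text \<open>Multiplying by \<open>2 ^ a\<close> clears the inverse, so the two branches of
  \<open>pow2_mod\<close> can be treated alike.\<close>

lemma cong_pow2_mod:
  assumes "coprime (2::int) (int p)" and "int a + e = int b"
  shows "[2 ^ a * pow2_mod p e = 2 ^ b] (mod int p)"
proof (cases "e \<ge> 0")
  case True
  hence "b = a + nat e" using assms(2) by simp
  thus ?thesis using True by (simp add: pow2_mod_def power_add)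
next
  case False
  hence a: "a = b + nat (- e)" using assms(2) by simp
  have "[2 ^ nat (- e) * modular_inverse (int p) (2 ^ nat (- e)) = 1] (mod int p)"
    using assms(1) by (intro cong_modular_inverse1) auto
  hence "[2 ^ b * (2 ^ nat (- e) * modular_inverse (int p) (2 ^ nat (- e))) = 2 ^ b * 1] (mod int p)"
    by (rule cong_scalar_left)
  thus ?thesis using False by (simp add: pow2_mod_def a power_add mult.assoc)
qed

lemma pow2_mod_add:
  assumes "coprime (2::int) (int p)"
  shows "[pow2_mod p (e + int n) = 2 ^ n * pow2_mod p e] (mod int p)"
proof -
  \<comment> \<open>One of the two exponents is 0. The factor \<open>2 ^ a\<close> makes both sides
    ordinary powers of 2 and cancels at the end, being coprime to \<open>p\<close>.\<close>
  define a b where "a = nat (- e)" and "b = nat e"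
  have ab: "int a + e = int b" by (simp add: a_def b_def)
  have "[2 ^ a * pow2_mod p (e + int n) = 2 ^ (b + n)] (mod int p)"
    using ab by (intro cong_pow2_mod assms) simp
  moreover have "[2 ^ n * (2 ^ a * pow2_mod p e) = 2 ^ n * 2 ^ b] (mod int p)"
    using ab by (intro cong_scalar_left cong_pow2_mod assms)
  ultimately have "[2 ^ a * pow2_mod p (e + int n) = 2 ^ a * (2 ^ n * pow2_mod p e)] (mod int p)"
    by (metis cong_sym cong_trans mult.commute mult.left_commute power_add)
  thus ?thesis
    using assms by (subst (asm) cong_mult_lcancel) auto
qed

lemma coprime_2_of_dvd_pow2_minus_1:
  assumes "p dvd 2 ^ m - 1" and "m > 0"
  shows "coprime (2::int) (int p)"
proof -
  have "odd ((2::nat) ^ m - 1)" using assms(2) by simp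
  hence "odd p" using assms(1) by (meson dvd_trans)
  thus ?thesis by simp
qed

text \<open>The translated system covers \<open>n\<close> because the original one covers
  \<open>n + c\<close>.\<close>

lemma covering_system_shift:
  assumes "covering_system \<tau> r m"
  shows "covering_system \<tau> (\<lambda>j. r j - c) m"
  unfolding covering_system_def
proof (intro conjI allI)
  show "\<forall>j\<in>{1..\<tau>}. m j > 0" using assms by (simp add: covering_system_def)
next
  fix n :: int
  obtain j where "j \<in> {1..\<tau>}" "[n + c = r j] (mod int (m j))"
    using assms unfolding covering_system_def by blast
  thus "\<exists>j\<in>{1..\<tau>}. [n = r j - c] (mod int (m j))"
    by (intro bexI[of _ j]) (auto simp: cong_iff_dvd_diff algebra_simps)
qed

text \<open>The sign \<open>s\<close> is \<open>-1\<close> in the Sierpinski case and \<open>1\<close> in the Riesel case.\<close>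

definition covers_repstring ::
    "int \<Rightarrow> nat \<Rightarrow> nat \<Rightarrow> nat \<Rightarrow> nat \<Rightarrow> nat \<Rightarrow> (nat \<Rightarrow> int) \<Rightarrow> (nat \<Rightarrow> nat) \<Rightarrow> (nat \<Rightarrow> nat) \<Rightarrow> bool"
  where
  "covers_repstring s k z T w \<tau> r m p \<longleftrightarrow>
     covering_system \<tau> r m \<and> inj_on p {1..\<tau>} \<and>
     (\<forall>j\<in>{1..\<tau>}. prime (p j) \<and> p j dvd 2 ^ m j - 1) \<and>
     (\<forall>j\<in>{1..\<tau>}. \<forall>t\<ge>1. [t = T] (mod w) \<longrightarrow>
        [int (repstring k z t) = s * pow2_mod (p j) (- r j)] (mod int (p j)))"

lemma repstring_reflect:
  assumes p: "coprime (2::int) (int p)" and "T \<ge> 1" and TT': "w dvd T + T'"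
    and rep: "\<And>t. t \<ge> 1 \<Longrightarrow> [t = T] (mod w) \<Longrightarrow>
      [int (repstring k z t) = s * pow2_mod p (- r)] (mod int p)"
    and t: "[t = T'] (mod w)"
  shows "[int (repstring k z t) =
    - s * pow2_mod p (- (r - int ((z + bin_length k) * T')))] (mod int p)"
proof -
  define A where "A t = int (repstring k z t)" for t
  define L where "L = z + bin_length k"
  have add: "A (a + b) = A a + 2 ^ (L * a) * A b" for a b
    by (simp add: A_def L_def repstring_add)
  have AT: "[A T = s * pow2_mod p (- r)] (mod int p)"
    using rep[of T] \<open>T \<ge> 1\<close> by (simp add: A_def)
  \<comment> \<open>\<open>T\<close> and \<open>T + w\<close> lie in the same class, and the
    repstrings there differ by \<open>2 ^ (L * T) * A w\<close>.\<close>
  have "[A (T + w) = s * pow2_mod p (- r)] (mod int p)"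
    using rep[of "T + w"] \<open>T \<ge> 1\<close> by (simp add: A_def cong_def)
  with AT have "[A (T + w) = A T] (mod int p)"
    by (metis cong_sym cong_trans)
  hence "int p dvd 2 ^ (L * T) * A w"
    by (simp add: add cong_iff_dvd_diff)
  hence "int p dvd A w"
    using p by (metis coprime_commute coprime_dvd_mult_right_iff coprime_power_right_iff)
  hence w: "p dvd repstring k z w" by (simp add: A_def)
  \<comment> \<open>Splitting this vanishing value after \<open>T'\<close> terms expresses
    \<open>A T'\<close> through \<open>A T\<close> with the opposite sign.\<close>
  have "p dvd repstring k z (T' + T)"
    using TT' dvd_repstring_mult[OF w] by (metis add.commute dvdE)
  hence "int p dvd A T' + 2 ^ (L * T') * A T"
    by (metis A_def add int_dvd_int_iff)
  hence "[A T' = - (2 ^ (L * T') * A T)] (mod int p)"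
    by (simp add: cong_iff_dvd_diff)
  also have "[- (2 ^ (L * T') * A T) = - (2 ^ (L * T') * (s * pow2_mod p (- r)))] (mod int p)"
    using AT by (simp add: cong_minus_minus_iff cong_scalar_left)
  also have "- (2 ^ (L * T') * (s * pow2_mod p (- r))) = - s * (2 ^ (L * T') * pow2_mod p (- r))"
    by simp
  also have "[\<dots> = - s * pow2_mod p (- r + int (L * T'))] (mod int p)"
    using pow2_mod_add[OF p] by (metis cong_scalar_left cong_sym)
  finally have "[A T' = - s * pow2_mod p (- (r - int (L * T')))] (mod int p)"
    by simp
  moreover have "[A t = A T'] (mod int p)"
    using repstring_cong[OF w t] by (simp add: A_def cong_int_iff)
  ultimately show ?thesis
    unfolding A_def L_def by (metis cong_trans)
qed

text \<open>The translation is the same for every \<open>j\<close>, so it preserves covering; moduli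
  and primes are kept.\<close>

lemma covers_repstring_reflect:
  assumes "covers_repstring s k z T w \<tau> r m p" and "T \<ge> 1" and "w dvd T + T'"
  shows "covers_repstring (- s) k z T' w \<tau> (\<lambda>j. r j - int ((z + bin_length k) * T')) m p"
  unfolding covers_repstring_def
proof (intro conjI ballI allI impI)
  fix j t assume j: "j \<in> {1..\<tau>}" and t: "[t = T'] (mod w)"
  have "coprime (2::int) (int (p j))"
    using assms(1) j by (intro coprime_2_of_dvd_pow2_minus_1[of _ "m j"])
      (auto simp: covers_repstring_def covering_system_def)
  thus "[int (repstring k z t) =
      - s * pow2_mod (p j) (- (r j - int ((z + bin_length k) * T')))] (mod int (p j))"
    using assms j t by (intro repstring_reflect[of _ T w]) (auto simp: covers_repstring_def)
qed (use assms(1) covering_system_shift in \<open>auto simp: covers_repstring_def\<close>)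

theorem theorem4p6:
  fixes k T w z :: nat
  assumes "k \<ge> 1" and "T \<ge> 1" and "w \<ge> 1"
  shows
    "(\<exists>(\<tau>::nat) (r::nat \<Rightarrow> int) (m::nat \<Rightarrow> nat) (p::nat \<Rightarrow> nat).
        covering_system \<tau> r m \<and>
        inj_on p {1..\<tau>} \<and>
        (\<forall>j\<in>{1..\<tau>}. prime (p j) \<and> p j dvd 2 ^ m j - 1) \<and>
        (\<forall>j\<in>{1..\<tau>}. \<forall>t::nat. t \<ge> 1 \<longrightarrow> [t = T] (mod w) \<longrightarrow>
           [int (repstring k z t) = - pow2_mod (p j) (- r j)] (mod int (p j))))
     \<longleftrightarrow>
     (\<exists>(\<tau>'::nat) (r'::nat \<Rightarrow> int) (m'::nat \<Rightarrow> nat) (p'::nat \<Rightarrow> nat).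
        covering_system \<tau>' r' m' \<and>
        inj_on p' {1..\<tau>'} \<and>
        (\<forall>j\<in>{1..\<tau>'}. prime (p' j) \<and> p' j dvd 2 ^ m' j - 1) \<and>
        (\<forall>j\<in>{1..\<tau>'}. \<forall>t'::nat. t' \<ge> 1 \<longrightarrow> [int t' = - int T] (mod int w) \<longrightarrow>
           [int (repstring k z t') = pow2_mod (p' j) (- r' j)] (mod int (p' j))))"
proof -
  \<comment> \<open>A representative of \<open>-T\<close> modulo \<open>w\<close>; the summand
    \<open>w\<close> keeps it positive even for \<open>w = 1\<close>, so that it can serve as the
    starting exponent of the converse reflection.\<close>
  define T' where "T' = T * (w - 1) + w"
  have sum: "T + T' = w * (T + 1)"
    using \<open>w \<ge> 1\<close> by (cases w) (simp_all add: T'_def)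
  have T': "T' \<ge> 1" using \<open>w \<ge> 1\<close> by (simp add: T'_def)
  have dvd: "w dvd T + T'" unfolding sum by simp
  hence "[int T' = - int T] (mod int w)"
    by (simp add: cong_iff_dvd_diff add.commute flip: of_nat_add)
  hence neg: "[int t = - int T] (mod int w) \<longleftrightarrow> [t = T'] (mod w)" for t
    by (metis cong_int_iff cong_sym cong_trans)
  have "(\<exists>\<tau> r m p. covers_repstring (- 1) k z T w \<tau> r m p) \<longleftrightarrow>
      (\<exists>\<tau> r m p. covers_repstring 1 k z T' w \<tau> r m p)"
    \<comment> \<open>Reflection is symmetric: exchanging \<open>T\<close> and \<open>T'\<close> and
      flipping the sign gives the converse.\<close>
    using covers_repstring_reflect[of "- 1" k z T w _ _ _ _ T'] dvd \<open>T \<ge> 1\<close>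
      covers_repstring_reflect[of 1 k z T' w _ _ _ _ T] T'
    by (simp add: add.commute) blast
  thus ?thesis
    by (simp add: covers_repstring_def neg)
qed

end
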